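(* With $A_m(x)=R_{2m}(x)$ and $B_m(x)=R_{2m+1}(x)$, as formal power series in $z$, \[ \sum_{m\ge 0}A_m(x)z^m = z+\frac{1-z+z^2}{1-(1+x+x^2)z+x^2z^2},\qquad \sum_{m\ge0}B_m(x)z^m=\frac{1+x-(x+x^2)z}{1-(1+x+x^2)z+x^2z^2}. \]
   Context: For $n\ge 0$, the $S$-fence $\phi_n$ is the poset on $\{x_1,\dots,x_n\}$ whose order is generated by the cover relations $x_2<x_1$, $x_3<x_2$, $x_2<x_4$, $x_5<x_4$, and, for every $i\ge 3$, $x_{2i-1}<x_{2i}$ and $x_{2i+1}<x_{2i}$, keeping only those relations whose elements both have index $\le n$ ($\phi_0$ is empty). A filter is an up-set. $\mathcal{F}(\phi_n)$ is the set of filters of $\phi_n$ ordered by reverse inclusion; it is a graded distributive lattice in which the rank of a filter $Y$ is $n-|Y|$. $r_{n,k}$ is the number of elements of rank $k$ in $\mathcal{F}(\phi_n)$ and $R_n(x)=\sum_{k\ge0}r_{n,k}x^k$. *)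

theory Defs
  imports
    "HOL-Computational_Algebra.Formal_Power_Series"
    "HOL-Computational_Algebra.Polynomial_Factorial"
begin

text \<open>
  The element \<open>x\<^sub>i\<close> of the S-fence \<open>\<phi>\<^sub>n\<close> is represented by its index \<open>i \<in> {1..n}\<close>;
  a pair \<open>(a, b)\<close> stands for \<open>x\<^sub>a < x\<^sub>b\<close>, resp. \<open>x\<^sub>a \<le> x\<^sub>b\<close>.
  The restriction to indices up to \<open>n\<close> is applied to the generating relations, before the
  closure is taken.
\<close>

definition fence_gen :: "nat \<Rightarrow> (nat \<times> nat) set" where
  "fence_gen n =
     ({(2, 1), (3, 2), (2, 4), (5, 4)}
       \<union> {(2 * i - 1, 2 * i) | i. 3 \<le> i} \<union> {(2 * i + 1, 2 * i) | i. 3 \<le> i})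
     \<inter> {1..n} \<times> {1..n}"

definition fence_le :: "nat \<Rightarrow> (nat \<times> nat) set" where
  "fence_le n = (fence_gen n)\<^sup>* \<inter> {1..n} \<times> {1..n}"

definition fence_filters :: "nat \<Rightarrow> nat set set" where
  "fence_filters n = {Y. Y \<subseteq> {1..n} \<and> (\<forall>a\<in>Y. \<forall>b. (a, b) \<in> fence_le n \<longrightarrow> b \<in> Y)}"

text \<open>
  The filters are ordered by reverse inclusion; \<open>filter_rank_bot\<close> and \<open>filter_rank_cover\<close> below
  show that this is the rank function of that lattice.
\<close>

definition filter_rank :: "nat \<Rightarrow> nat set \<Rightarrow> nat" where
  "filter_rank n Y = n - card Y"

definition fence_r :: "nat \<Rightarrow> nat \<Rightarrow> nat" where
  "fence_r n k = card {Y \<in> fence_filters n. filter_rank n Y = k}"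

text \<open>The rank never exceeds \<open>n\<close>, so the sum over all \<open>k\<close> stops there; see \<open>coeff_fence_R\<close>.\<close>

definition fence_R :: "nat \<Rightarrow> int poly" where
  "fence_R n = (\<Sum>k\<le>n. monom (int (fence_r n k)) k)"

definition fence_A :: "nat \<Rightarrow> int poly" where
  "fence_A m = fence_R (2 * m)"

definition fence_B :: "nat \<Rightarrow> int poly" where
  "fence_B m = fence_R (2 * m + 1)"

text \<open>
  Power series in \<open>z\<close> have coefficients in the field of rational functions in \<open>x\<close>, so that
  division of series is the library one; \<open>to_fract\<close> embeds the polynomials in \<open>x\<close> injectively.
\<close>

abbreviation x_var :: "int poly fract fps" where
  "x_var \<equiv> fps_const (to_fract [:0, 1:])"

abbreviation z_var :: "int poly fract fps" where
  "z_var \<equiv> fps_X"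


lemma coeff_fence_R: "coeff (fence_R n) k = int (fence_r n k)"
proof -
  have "fence_r n k = 0" if "k > n"
  proof -
    have "{Y \<in> fence_filters n. filter_rank n Y = k} = {}"
      using that by (auto simp: filter_rank_def)
    then show ?thesis by (simp only: fence_r_def card.empty)
  qed
  then show ?thesis
    by (auto simp: fence_R_def coeff_sum not_le)
qed

definition fence_height :: "nat \<Rightarrow> nat" where
  "fence_height a = (if a = 1 then 2 else if a = 2 then 1 else if even a then 2 else 0)"

lemma fence_gen_height: "(a, b) \<in> fence_gen n \<Longrightarrow> fence_height a < fence_height b"
  by (auto simp: fence_gen_def fence_height_def)

lemma fence_le_height: "(a, b) \<in> fence_le n \<Longrightarrow> a = b \<or> fence_height a < fence_height b"
proof -
  assume "(a, b) \<in> fence_le n"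
  then have "(a, b) \<in> (fence_gen n)\<^sup>*" by (simp add: fence_le_def)
  then show ?thesis
    by (induction rule: rtrancl_induct) (auto dest: fence_gen_height)
qed

lemma partial_order_fence: "partial_order_on {1..n} (fence_le n)"
  unfolding partial_order_on_def preorder_on_def
proof (intro conjI)
  show "fence_le n \<subseteq> {1..n} \<times> {1..n}" by (auto simp: fence_le_def)
  show "refl_on {1..n} (fence_le n)" by (auto simp: refl_on_def fence_le_def)
  show "trans (fence_le n)"
    unfolding fence_le_def by (intro trans_Int trans_rtrancl) (auto simp: trans_def)
  show "antisym (fence_le n)"
    using fence_le_height by (intro antisymI) (metis less_asym')
qed

lemma filter_rank_bot:
  "{1..n} \<in> fence_filters n" "filter_rank n {1..n} = 0"
  by (auto simp: fence_filters_def fence_le_def filter_rank_def)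

lemma filter_rank_cover:
  assumes "Y \<in> fence_filters n" "Z \<in> fence_filters n" "Z \<subset> Y"
    and no_between: "\<not> (\<exists>W \<in> fence_filters n. Z \<subset> W \<and> W \<subset> Y)"
  shows "filter_rank n Z = Suc (filter_rank n Y)"
proof -
  have YZ: "Y \<subseteq> {1..n}" "finite Y"
    using assms(1) by (auto simp: fence_filters_def intro: finite_subset)
  obtain a where a: "a \<in> Y - Z"
      and min: "\<And>b. b \<in> Y - Z \<Longrightarrow> fence_height a \<le> fence_height b"
  proof -
    obtain a0 where "a0 \<in> Y - Z" using assms(3) by auto
    then show thesis
      using ex_has_least_nat[of "\<lambda>a. a \<in> Y - Z" a0 fence_height] that by (metis (no_types))
  qed
  have "Y - {a} \<in> fence_filters n"
    unfolding fence_filters_def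
  proof (intro CollectI conjI ballI allI impI)
    show "Y - {a} \<subseteq> {1..n}" using YZ by auto
    fix b c assume b: "b \<in> Y - {a}" and bc: "(b, c) \<in> fence_le n"
    have "c \<in> Y" using b bc assms(1) by (auto simp: fence_filters_def)
    moreover have "c \<noteq> a"
    proof
      assume "c = a"
      then have "b \<notin> Z" using a bc assms(2) by (auto simp: fence_filters_def)
      then have "fence_height a \<le> fence_height b" using b min by auto
      then show False using fence_le_height[OF bc] b \<open>c = a\<close> by auto
    qed
    ultimately show "c \<in> Y - {a}" by auto
  qed
  then have "\<not> (Z \<subset> Y - {a} \<and> Y - {a} \<subset> Y)" using no_between by (metis (no_types))
  moreover have "Z \<subseteq> Y - {a}" "Y - {a} \<subset> Y" using a assms(3) by auto
  ultimately have "Z = Y - {a}" by (simp add: psubset_eq)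
  moreover have "card Y \<le> n" using card_mono[OF _ YZ(1)] by simp
  moreover have "card Y > 0" using a YZ(2) by (auto simp: card_gt_0_iff)
  ultimately show ?thesis using a YZ(2) by (auto simp: filter_rank_def card_Diff_singleton)
qed

end

theory Submission
  imports Defs
begin

unbundle fps_syntax

text \<open>
  Split the filters of \<open>\<phi>\<^sub>n\<close> according to whether they contain \<open>x\<^sub>n\<close>.
  In every case the principal down-set of \<open>x\<^sub>n\<close> is a final segment \<open>{p+1..n}\<close> of the indices
  and its principal up-set a final segment \<open>{q+1..n}\<close>, so that the two classes are counted
  by \<open>x\<^sup>n\<^sup>-\<^sup>p R\<^sub>p\<close> and \<open>R\<^sub>q\<close>. From \<open>n = 5\<close> on, this gives \<open>R\<^sub>n = x R\<^sub>n\<^sub>-\<^sub>1 + R\<^sub>n\<^sub>-\<^sub>2\<close> for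
  odd \<open>n\<close> and \<open>R\<^sub>n = x\<^sup>2 R\<^sub>n\<^sub>-\<^sub>2 + R\<^sub>n\<^sub>-\<^sub>1\<close> for even \<open>n\<close>; eliminating one parity yields the
  linear recurrence with characteristic polynomial \<open>1 - (1 + x + x\<^sup>2) z + x\<^sup>2 z\<^sup>2\<close> for the other.
\<close>

section \<open>Filters via generating relations\<close>

text \<open>Closure under single generating relations propagates along chains. Later checks thus
  only involve \<open>fence_gen\<close>.\<close>

lemma fence_filters_iff_gen:
  "Y \<in> fence_filters n \<longleftrightarrow> Y \<subseteq> {1..n} \<and> (\<forall>a b. (a, b) \<in> fence_gen n \<longrightarrow> a \<in> Y \<longrightarrow> b \<in> Y)"
proof
  assume Y: "Y \<in> fence_filters n"
  have "fence_gen n \<subseteq> fence_le n" by (auto simp: fence_le_def fence_gen_def)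
  then show "Y \<subseteq> {1..n} \<and> (\<forall>a b. (a, b) \<in> fence_gen n \<longrightarrow> a \<in> Y \<longrightarrow> b \<in> Y)"
    using Y by (auto simp: fence_filters_def)
next
  assume Y: "Y \<subseteq> {1..n} \<and> (\<forall>a b. (a, b) \<in> fence_gen n \<longrightarrow> a \<in> Y \<longrightarrow> b \<in> Y)"
  have "b \<in> Y" if "(a, b) \<in> (fence_gen n)\<^sup>*" "a \<in> Y" for a b
    using that by (induction rule: rtrancl_induct) (use Y in auto)
  then show "Y \<in> fence_filters n"
    using Y by (auto simp: fence_filters_def fence_le_def)
qed

lemma fence_filters_subset: "Y \<in> fence_filters n \<Longrightarrow> Y \<subseteq> {1..n}"
  by (simp add: fence_filters_def)

lemma finite_fence_filters: "finite (fence_filters n)"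
  by (rule finite_subset[of _ "Pow {1..n}"]) (auto simp: fence_filters_def)

lemma fence_gen_restrict: "p \<le> n \<Longrightarrow> fence_gen p = fence_gen n \<inter> {1..p} \<times> {1..p}"
  unfolding fence_gen_def by force

text \<open>Written as a weight sum over filters, the polynomial splits whenever the set of filters
  does.\<close>

lemma fence_R_sum_filters: "fence_R n = (\<Sum>Y\<in>fence_filters n. monom 1 (filter_rank n Y))"
proof (rule poly_eqI)
  fix k
  have "(\<Sum>Y\<in>fence_filters n. if filter_rank n Y = k then 1 else 0 :: int)
      = int (card {Y \<in> fence_filters n. filter_rank n Y = k})"
    by (simp add: sum.If_cases finite_fence_filters Int_def)
  then show "coeff (fence_R n) k = coeff (\<Sum>Y\<in>fence_filters n. monom 1 (filter_rank n Y)) k"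
    by (simp add: coeff_fence_R fence_r_def coeff_sum)
qed

section \<open>Splitting the filters by their last element\<close>

text \<open>By \<open>down\<close> and \<open>down_gen\<close>, \<open>{p<..n}\<close> is the
  principal down-set of \<open>n\<close>; by \<open>up\<close> and \<open>up_gen\<close>,
  \<open>{q<..n}\<close> is its principal up-set. A filter omitting \<open>n\<close> omits the
  former, a filter containing \<open>n\<close> contains the latter. Conversely, no relation leads
  from \<open>{1..p}\<close> into the down-set or out of the up-set into
  \<open>{1..q}\<close>.\<close>

lemma fence_filters_split:
  assumes p: "p < n" and q: "q < n"
    and down: "\<And>a b. (a, b) \<in> fence_gen n \<Longrightarrow> p < b \<Longrightarrow> p < a"
    and down_gen: "\<And>i. p < i \<Longrightarrow> i \<le> n \<Longrightarrow> (i, n) \<in> (fence_gen n)\<^sup>*"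
    and up: "\<And>a b. (a, b) \<in> fence_gen n \<Longrightarrow> q < a \<Longrightarrow> q < b"
    and up_gen: "\<And>i. q < i \<Longrightarrow> i \<le> n \<Longrightarrow> (n, i) \<in> (fence_gen n)\<^sup>*"
  shows "fence_filters n = fence_filters p \<union> (\<lambda>Y. Y \<union> {q<..n}) ` fence_filters q"
proof (intro equalityI subsetI)
  fix Y assume Y: "Y \<in> fence_filters n"
  then have Yn: "Y \<subseteq> {1..n}"
    and gen: "\<And>a b. (a, b) \<in> fence_gen n \<Longrightarrow> a \<in> Y \<Longrightarrow> b \<in> Y"
    by (auto simp: fence_filters_iff_gen)
  have le: "b \<in> Y" if "(a, b) \<in> (fence_gen n)\<^sup>*" "a \<in> Y" for a b
    using that by (induction rule: rtrancl_induct) (use gen in auto)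
  show "Y \<in> fence_filters p \<union> (\<lambda>Y. Y \<union> {q<..n}) ` fence_filters q"
  proof (cases "n \<in> Y")
    case True
    have "{q<..n} \<subseteq> Y" using le[OF up_gen] True by auto
    then have eq: "Y = (Y \<inter> {1..q}) \<union> {q<..n}" using Yn by auto
    have "Y \<inter> {1..q} \<in> fence_filters q"
      using gen q by (auto simp: fence_filters_iff_gen fence_gen_restrict[of q n])
    then show ?thesis using eq by blast
  next
    case False
    have "Y \<subseteq> {1..p}"
    proof
      fix i assume "i \<in> Y"
      then show "i \<in> {1..p}" using le[OF down_gen, of i] Yn False by (cases "p < i") auto
    qed
    then have "Y \<in> fence_filters p"
      using gen p by (auto simp: fence_filters_iff_gen fence_gen_restrict[of p n])
    then show ?thesis by blast
  qed
next
  fix Y assume "Y \<in> fence_filters p \<union> (\<lambda>Y. Y \<union> {q<..n}) ` fence_filters q"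
  then consider "Y \<in> fence_filters p"
    | Z where "Z \<in> fence_filters q" "Y = Z \<union> {q<..n}" by auto
  then show "Y \<in> fence_filters n"
  proof cases
    case 1
    then have "Y \<subseteq> {1..p}"
      and gen: "\<And>a b. (a, b) \<in> fence_gen p \<Longrightarrow> a \<in> Y \<Longrightarrow> b \<in> Y"
      by (auto simp: fence_filters_iff_gen)
    have "b \<in> Y" if ab: "(a, b) \<in> fence_gen n" and a: "a \<in> Y" for a b
    proof (rule gen[OF _ a])
      have "a \<le> p" using a \<open>Y \<subseteq> {1..p}\<close> by auto
      then have "b \<le> p" using down[OF ab] by linarith
      then show "(a, b) \<in> fence_gen p"
        using ab \<open>a \<le> p\<close> p by (auto simp: fence_gen_restrict[of p n]) (auto simp: fence_gen_def)
    qed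
    then show ?thesis using \<open>Y \<subseteq> {1..p}\<close> p by (auto simp: fence_filters_iff_gen)
  next
    case 2
    then have "Z \<subseteq> {1..q}"
      and gen: "\<And>a b. (a, b) \<in> fence_gen q \<Longrightarrow> a \<in> Z \<Longrightarrow> b \<in> Z"
      by (auto simp: fence_filters_iff_gen)
    have "b \<in> Y" if ab: "(a, b) \<in> fence_gen n" and a: "a \<in> Y" for a b
    proof (cases "q < b")
      case True
      then show ?thesis using ab 2 by (auto simp: fence_gen_def)
    next
      case False
      then have "a \<le> q" using up[OF ab] by linarith
      then have "a \<in> Z" "(a, b) \<in> fence_gen q"
        using ab False a q 2
        by (auto simp: fence_gen_restrict[of q n]) (auto simp: fence_gen_def)
      then show ?thesis using gen 2 by blast
    qed
    then show ?thesis using 2 \<open>Z \<subseteq> {1..q}\<close> q by (fastforce simp: fence_filters_iff_gen)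
  qed
qed

lemma fence_R_split:
  assumes p: "p < n" and q: "q < n"
    and split: "fence_filters n = fence_filters p \<union> (\<lambda>Y. Y \<union> {q<..n}) ` fence_filters q"
  shows "fence_R n = [:0, 1:] ^ (n - p) * fence_R p + fence_R q"
proof -
  let ?f = "\<lambda>Y. Y \<union> {q<..n}"
  \<comment> \<open>The element \<open>n\<close> lies in every set of the second family and in none
    of the first.\<close>
  have disj: "fence_filters p \<inter> ?f ` fence_filters q = {}"
    using p q fence_filters_subset[of _ p] by fastforce
  have inj: "inj_on ?f (fence_filters q)"
  proof (rule inj_onI)
    fix Y Z assume YZ: "Y \<in> fence_filters q" "Z \<in> fence_filters q" "?f Y = ?f Z"
    have "?f Y \<inter> {1..q} = Y" "?f Z \<inter> {1..q} = Z"
      using YZ(1,2)[THEN fence_filters_subset] by auto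
    then show "Y = Z" using YZ(3) by simp
  qed
  have rank_p: "filter_rank n Y = (n - p) + filter_rank p Y" if "Y \<in> fence_filters p" for Y
    using card_mono[OF _ fence_filters_subset[OF that]] p by (simp add: filter_rank_def)
  have rank_q: "filter_rank n (?f Y) = filter_rank q Y" if "Y \<in> fence_filters q" for Y
  proof -
    have Y: "Y \<subseteq> {1..q}" using that by (rule fence_filters_subset)
    then have "card (?f Y) = card Y + (n - q)"
      by (subst card_Un_disjoint) (auto intro: finite_subset)
    then show ?thesis using q by (simp add: filter_rank_def)
  qed
  have "fence_R n = (\<Sum>Y\<in>fence_filters p. monom 1 (filter_rank n Y))
      + (\<Sum>Y\<in>fence_filters q. monom 1 (filter_rank n (?f Y)))"
    by (simp add: fence_R_sum_filters split sum.union_disjoint disj finite_fence_filters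
        sum.reindex[OF inj] o_def)
  also have "\<dots> = (\<Sum>Y\<in>fence_filters p. monom 1 (n - p) * monom 1 (filter_rank p Y)) + fence_R q"
    by (simp add: fence_R_sum_filters rank_p rank_q mult_monom)
  also have "\<dots> = monom 1 (n - p) * fence_R p + fence_R q"
    by (simp add: fence_R_sum_filters sum_distrib_left)
  finally show ?thesis by (simp add: monom_altdef)
qed

section \<open>Initial values and recurrences\<close>

lemma fence_R_0: "fence_R 0 = 1"
proof -
  have "fence_filters 0 = {{}}" by (auto simp: fence_filters_def)
  then show ?thesis by (simp add: fence_R_sum_filters filter_rank_def)
qed

lemma fence_R_1: "fence_R 1 = [:0, 1:] + 1"
proof -
  have "fence_R 1 = [:0, 1:] ^ (1 - 0) * fence_R 0 + fence_R 0"
    by (intro fence_R_split fence_filters_split)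
      (auto simp: fence_gen_def le_Suc_eq)
  then show ?thesis by (simp add: fence_R_0)
qed

lemma fence_R_2: "fence_R 2 = [:0, 1:] * fence_R 1 + 1"
proof -
  have g: "(2, 1) \<in> fence_gen 2" by (simp add: fence_gen_def)
  have "fence_R 2 = [:0, 1:] ^ (2 - 1) * fence_R 1 + fence_R 0"
  proof (intro fence_R_split fence_filters_split)
    fix i :: nat assume "0 < i" "i \<le> 2"
    then have "i = 1 \<or> i = 2" by linarith
    then show "(2, i) \<in> (fence_gen 2)\<^sup>*" using g by auto
  next
    fix i :: nat assume "1 < i" "i \<le> 2"
    then have "i = 2" by linarith
    then show "(i, 2) \<in> (fence_gen 2)\<^sup>*" by simp
  qed (auto simp: fence_gen_def)
  then show ?thesis by (simp add: fence_R_0)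
qed

lemma fence_R_3: "fence_R 3 = [:0, 1:] * fence_R 2 + 1"
proof -
  have g: "(2, 1) \<in> fence_gen 3" "(3, 2) \<in> fence_gen 3" by (simp_all add: fence_gen_def)
  \<comment> \<open>\<open>3 < 2 < 1\<close> is a chain, so the up-set of its bottom 3 is everything
    and \<open>q = 0\<close>.\<close>
  have "fence_R 3 = [:0, 1:] ^ (3 - 2) * fence_R 2 + fence_R 0"
  proof (intro fence_R_split fence_filters_split)
    fix i :: nat assume "0 < i" "i \<le> 3"
    then have "i = 1 \<or> i = 2 \<or> i = 3" by linarith
    then show "(3, i) \<in> (fence_gen 3)\<^sup>*"
      using g by (auto intro: converse_rtrancl_into_rtrancl)
  next
    fix i :: nat assume "2 < i" "i \<le> 3"
    then have "i = 3" by linarith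
    then show "(i, 3) \<in> (fence_gen 3)\<^sup>*" by simp
  qed (auto simp: fence_gen_def)
  then show ?thesis by (simp add: fence_R_0)
qed

lemma fence_R_4: "fence_R 4 = [:0, 1:] ^ 3 * fence_R 1 + fence_R 3"
proof -
  have g: "(2, 4) \<in> fence_gen 4" "(3, 2) \<in> fence_gen 4" by (simp_all add: fence_gen_def)
  \<comment> \<open>The irregular step: below 4 lie both 2 and 3, whence the exponent 3; 4 is
    maximal.\<close>
  have "fence_R 4 = [:0, 1:] ^ (4 - 1) * fence_R 1 + fence_R 3"
  proof (intro fence_R_split fence_filters_split)
    fix i :: nat assume "1 < i" "i \<le> 4"
    then have "i = 2 \<or> i = 3 \<or> i = 4" by linarith
    then show "(i, 4) \<in> (fence_gen 4)\<^sup>*"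
      using g by (auto intro: converse_rtrancl_into_rtrancl)
  next
    fix i :: nat assume "3 < i" "i \<le> 4"
    then have "i = 4" by linarith
    then show "(4, i) \<in> (fence_gen 4)\<^sup>*" by simp
  qed (auto simp: fence_gen_def)
  then show ?thesis by simp
qed

lemma fence_R_odd:
  assumes "m \<ge> 2"
  shows "fence_R (2 * m + 1) = [:0, 1:] * fence_R (2 * m) + fence_R (2 * m - 1)"
proof -
  let ?n = "2 * m + 1"
  have g: "(?n, 2 * m) \<in> fence_gen ?n"
    \<comment> \<open>For \<open>m = 2\<close> this is the separately listed relation
      \<open>(5, 4)\<close>.\<close>
    using assms by (cases "m = 2") (auto simp: fence_gen_def)
  have "fence_R ?n = [:0, 1:] ^ (?n - 2 * m) * fence_R (2 * m) + fence_R (2 * m - 1)"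
  proof (intro fence_R_split fence_filters_split)
    fix i assume "2 * m - 1 < i" "i \<le> ?n"
    then have "i = 2 * m \<or> i = ?n" by linarith
    then show "(?n, i) \<in> (fence_gen ?n)\<^sup>*" using g by auto
  next
    fix i assume "2 * m < i" "i \<le> ?n"
    then have "i = ?n" by linarith
    then show "(i, ?n) \<in> (fence_gen ?n)\<^sup>*" by simp
  next
    \<comment> \<open>Parity decides: from index 4 on, only odd indices are lower ends and only even
      ones upper ends. Hence \<open>?n\<close> is minimal, and its only upper neighbour is
      \<open>2 * m\<close>, as \<open>2 * m + 2\<close> exceeds \<open>?n\<close>.\<close>
    fix a b assume "(a, b) \<in> fence_gen ?n"
    then show "2 * m < b \<Longrightarrow> 2 * m < a" and "2 * m - 1 < a \<Longrightarrow> 2 * m - 1 < b"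
      using assms unfolding fence_gen_def by (auto, presburger+)
  qed (use assms in simp_all)
  then show ?thesis by simp
qed

lemma fence_R_even:
  assumes "m \<ge> 3"
  shows "fence_R (2 * m) = [:0, 1:] ^ 2 * fence_R (2 * m - 2) + fence_R (2 * m - 1)"
proof -
  let ?n = "2 * m"
  have g: "(?n - 1, ?n) \<in> fence_gen ?n" using assms by (auto simp: fence_gen_def)
  have "fence_R ?n = [:0, 1:] ^ (?n - (?n - 2)) * fence_R (?n - 2) + fence_R (?n - 1)"
  proof (intro fence_R_split fence_filters_split)
    fix i assume "?n - 2 < i" "i \<le> ?n"
    then have "i = ?n - 1 \<or> i = ?n" by linarith
    then show "(i, ?n) \<in> (fence_gen ?n)\<^sup>*" using g by auto
  next
    fix i assume "?n - 1 < i" "i \<le> ?n"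
    then have "i = ?n" by linarith
    then show "(?n, i) \<in> (fence_gen ?n)\<^sup>*" by simp
  next
    \<comment> \<open>Dually, \<open>?n\<close> is maximal, with only \<open>?n - 1\<close> below it
      since \<open>?n + 1\<close> is cut off.\<close>
    fix a b assume "(a, b) \<in> fence_gen ?n"
    then show "?n - 2 < b \<Longrightarrow> ?n - 2 < a" and "?n - 1 < a \<Longrightarrow> ?n - 1 < b"
      using assms unfolding fence_gen_def by (auto, presburger+)
  qed (use assms in simp_all)
  moreover have "?n - (?n - 2) = 2" using assms by linarith
  ultimately show ?thesis by simp
qed

lemma fence_A_rec: "m \<ge> 2 \<Longrightarrow> fence_A (Suc m) = [:0, 1:] ^ 2 * fence_A m + fence_B m"
  using fence_R_even[of "Suc m"] by (simp add: fence_A_def fence_B_def)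

lemma fence_B_rec: "m \<ge> 1 \<Longrightarrow> fence_B (Suc m) = [:0, 1:] * fence_A (Suc m) + fence_B m"
  using fence_R_odd[of "Suc m"] by (simp add: fence_A_def fence_B_def)

section \<open>Generating functions\<close>

text \<open>Serves to check an identity with the common denominator coefficientwise, with
  \<open>c = 1 + x + x ^ 2\<close> and \<open>d = x ^ 2\<close>.\<close>

lemma fps_mult_quadratic_nth:
  fixes f :: "'a::comm_ring_1 fps"
  defines "D \<equiv> \<lambda>c d. 1 - fps_const c * fps_X + fps_const d * fps_X ^ 2"
  shows "(f * D c d) $ 0 = f $ 0"
    and "(f * D c d) $ Suc 0 = f $ 1 - c * f $ 0"
    and "(f * D c d) $ Suc (Suc n) = f $ Suc (Suc n) - c * f $ Suc n + d * f $ n"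
proof -
  have *: "f * D c d = f - fps_const c * (fps_X * f) + fps_const d * (fps_X * (fps_X * f))"
    by (simp add: D_def algebra_simps power2_eq_square)
  show "(f * D c d) $ 0 = f $ 0"
    and "(f * D c d) $ Suc 0 = f $ 1 - c * f $ 0"
    and "(f * D c d) $ Suc (Suc n) = f $ Suc (Suc n) - c * f $ Suc n + d * f $ n"
    by (simp_all add: *)
qed

lemma fps_eq_divide_iff:
  fixes f g h :: "'a::field fps"
  assumes "h $ 0 \<noteq> 0"
  shows "f = g / h \<longleftrightarrow> f * h = g"
proof -
  have "h * inverse h = 1" using assms by (rule inverse_mult_eq_1')
  then show ?thesis using assms by (auto simp: fps_divide_unit mult.assoc ac_simps)
qed

theorem theorem1:
  "Abs_fps (\<lambda>m. to_fract (fence_A m)) =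
           z_var + (1 - z_var + z_var ^ 2)
             / (1 - (1 + x_var + x_var ^ 2) * z_var + x_var ^ 2 * z_var ^ 2)
   \<and> Abs_fps (\<lambda>m. to_fract (fence_B m)) =
           (1 + x_var - (x_var + x_var ^ 2) * z_var)
             / (1 - (1 + x_var + x_var ^ 2) * z_var + x_var ^ 2 * z_var ^ 2)"
proof -
  define x :: "int poly fract" where "x = to_fract [:0, 1:]"
  define a where "a m = to_fract (fence_A m)" for m
  define b where "b m = to_fract (fence_B m)" for m
  define D where "D = 1 - fps_const (1 + x + x ^ 2) * fps_X + fps_const (x ^ 2) * fps_X ^ 2"
  have pow: "to_fract (p ^ k) = to_fract p ^ k" for p :: "int poly" and k
    by (induction k) simp_all
  have a0: "a 0 = 1" by (simp add: a_def fence_A_def fence_R_0)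
  have b0: "b 0 = x + 1" using fence_R_1 by (simp add: b_def fence_B_def x_def)
  have a1: "a 1 = x * b 0 + 1"
    using fence_R_2 by (simp add: a_def b_def fence_A_def fence_B_def x_def del: mult_pCons_left)
  have b1: "b 1 = x * a 1 + 1"
    using fence_R_3 by (simp add: a_def b_def fence_A_def fence_B_def x_def del: mult_pCons_left)
  have a2: "a 2 = x ^ 3 * b 0 + b 1"
    using fence_R_4 by (simp add: a_def b_def fence_A_def fence_B_def x_def pow del: mult_pCons_left)
  have ar: "a (Suc m) = x ^ 2 * a m + b m" if "m \<ge> 2" for m
    using fence_A_rec[OF that] by (simp add: a_def b_def x_def pow del: mult_pCons_left)
  have br: "b (Suc m) = x * a (Suc m) + b m" if "m \<ge> 1" for m
    using fence_B_rec[OF that] by (simp add: a_def b_def x_def del: mult_pCons_left)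
  \<comment> \<open>The isolated summand z corrects the irregular start: since
    \<open>a 1 - 1 = x * b 0\<close>, the value \<open>a 2\<close> equals
    \<open>x ^ 2 * (a 1 - 1) + b 1\<close>, which is the regular recurrence with \<open>a 1\<close>
    lowered by 1.\<close>
  have A: "(Abs_fps a - fps_X) * D = 1 - fps_X + fps_X ^ 2"
  proof (rule fps_ext)
    fix n
    \<comment> \<open>The general case applies \<open>ar\<close> at \<open>k\<close> and
      \<open>k + 1\<close>, hence needs \<open>k \<ge> 2\<close>; the coefficient at 3 still
      involves the altered \<open>a 1\<close>.\<close>
    consider "n = 0" | "n = 1" | "n = 2" | "n = 3" | k where "n = Suc (Suc k)" "k \<ge> 2"
      by (metis One_nat_def Suc_1 le_eq_less_or_eq less_2_cases not_less numeral_3_eq_3 old.nat.exhaust)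
    then show "((Abs_fps a - fps_X) * D) $ n = (1 - fps_X + fps_X ^ 2) $ n"
    proof cases
      case 3
      then show ?thesis unfolding D_def using a0 a1 a2 b0 b1
        by (simp add: numeral_2_eq_2 fps_mult_quadratic_nth fps_X_power_nth)
          (simp add: algebra_simps eval_nat_numeral)
    next
      case 4
      then show ?thesis unfolding D_def using a0 a1 a2 b0 b1 ar[of 2] br[of 1]
        by (simp add: numeral_2_eq_2 numeral_3_eq_3 fps_mult_quadratic_nth fps_X_power_nth)
          (simp add: algebra_simps eval_nat_numeral)
    next
      case (5 k)
      have "a (Suc (Suc k)) = x ^ 2 * a (Suc k) + (x * a (Suc k) + b k)"
        using ar[of "Suc k"] br[of k] 5 by simp
      \<comment> \<open>This eliminates the odd-index polynomials.\<close>
      moreover have "b k = a (Suc k) - x ^ 2 * a k"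
        using ar[of k] 5 by simp
      ultimately show ?thesis unfolding D_def using 5
        by (simp add: fps_mult_quadratic_nth fps_X_power_nth) (simp add: algebra_simps)
    qed (unfold D_def, use a0 a1 b0 in \<open>simp_all add: fps_mult_quadratic_nth algebra_simps power2_eq_square\<close>)
  qed
  have B: "Abs_fps b * D = 1 + fps_const x - fps_const (x + x ^ 2) * fps_X"
  proof (rule fps_ext)
    fix n
    \<comment> \<open>Here \<open>ar\<close> enters only at \<open>k + 1\<close>, so
      \<open>k \<ge> 1\<close> suffices.\<close>
    consider "n = 0" | "n = 1" | "n = 2" | k where "n = Suc (Suc k)" "k \<ge> 1"
      by (metis One_nat_def Suc_1 le_eq_less_or_eq less_2_cases not_less old.nat.exhaust less_one)
    then show "(Abs_fps b * D) $ n = (1 + fps_const x - fps_const (x + x ^ 2) * fps_X) $ n"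
    proof cases
      case 3
      then show ?thesis unfolding D_def using a0 a1 a2 b0 b1 br[of 1]
        by (simp add: numeral_2_eq_2 fps_mult_quadratic_nth)
          (simp add: algebra_simps eval_nat_numeral)
    next
      case (4 k)
      have "b (Suc (Suc k)) = x * (x ^ 2 * a (Suc k) + b (Suc k)) + b (Suc k)"
        using ar[of "Suc k"] br[of "Suc k"] 4 by simp
      \<comment> \<open>The even-index polynomials occur only multiplied by \<open>x\<close>, so
        they can be eliminated without dividing.\<close>
      moreover have "x * a (Suc k) = b (Suc k) - b k"
        using br[of k] 4 by simp
      ultimately have "b (Suc (Suc k)) = x ^ 2 * (b (Suc k) - b k) + x * b (Suc k) + b (Suc k)"
        by (metis (no_types, lifting) distrib_left mult.left_commute)
      then show ?thesis unfolding D_def using 4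
        by (simp add: fps_mult_quadratic_nth) (simp add: algebra_simps)
    qed (unfold D_def, use a0 a1 b0 b1 in \<open>simp_all add: fps_mult_quadratic_nth algebra_simps eval_nat_numeral\<close>)
  qed
  \<comment> \<open>The constant term is 1, so \<open>D\<close> is a unit and the products
    \<open>A\<close> and \<open>B\<close> turn into quotients.\<close>
  have D0: "D $ 0 \<noteq> 0" by (simp add: D_def)
  have D_eq: "1 - (1 + x_var + x_var ^ 2) * z_var + x_var ^ 2 * z_var ^ 2 = D"
    by (simp add: D_def x_def fps_const_power flip: fps_const_add)
  have B_num: "1 + x_var - (x_var + x_var ^ 2) * z_var
      = 1 + fps_const x - fps_const (x + x ^ 2) * fps_X"
    by (simp add: x_def fps_const_power)
  have "Abs_fps a - fps_X = (1 - fps_X + fps_X ^ 2) / D"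
    using A by (simp only: fps_eq_divide_iff[OF D0])
  then have "Abs_fps a = fps_X + (1 - fps_X + fps_X ^ 2) / D"
    by (simp only: diff_eq_eq add.commute)
  moreover have "Abs_fps b = (1 + x_var - (x_var + x_var ^ 2) * z_var) / D"
    unfolding B_num using B by (simp only: fps_eq_divide_iff[OF D0])
  ultimately show ?thesis
    unfolding D_eq a_def b_def by blast
qed

end
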